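(* Let $k\ge 3$ and let $D$ be a $k$-partite tournament. Then $\mathcal{N}(D)$ contains no induced path of length $5$; that is, $\mathcal{N}(D)$ is $P_6$-free.
   Context: $P_6$ denotes the path on $6$ vertices (length $5$). A $k$-partite tournament is an orientation of a complete $k$-partite graph with $k$ nonempty partite sets. The niche graph $\mathcal{N}(D)$ of a digraph $D$ has vertex set $V(D)$, and two distinct vertices are adjacent iff they have a common out-neighbor in $D$ or a common in-neighbor in $D$. *)

theory Defs
  imports
    "Graph_Theory.Digraph_Component"
    "Graph_Theory.Digraph_Isomorphism"
    "Graph_Theory.Pair_Digraph"
    "HOL-Library.Disjoint_Sets"
begin

text \<open>
  Digraphs without parallel arcs are pair digraphs.  As usual for this representation, an undirected
  simple graph is a symmetric loop-free digraph: an edge \<open>uv\<close> is the pair of arcs \<open>(u,v)\<close>, \<open>(v,u)\<close>.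
  No finiteness of the vertex set is required.
\<close>

definition complete_multipartite_graph :: "'a set set \<Rightarrow> 'a pair_pre_digraph" where
  "complete_multipartite_graph P =
     \<lparr> pverts = \<Union>P, parcs = {(u, v). \<exists>X\<in>P. \<exists>Y\<in>P. X \<noteq> Y \<and> u \<in> X \<and> v \<in> Y} \<rparr>"

text \<open>
  \<open>mk_symmetric\<close> forgets the directions of the arcs; \<open>asym\<close> says that no edge is directed both ways
  (and that there are no loops).
\<close>

definition orientation_of :: "'a pair_pre_digraph \<Rightarrow> 'a pair_pre_digraph \<Rightarrow> bool" where
  "orientation_of D G \<longleftrightarrow> mk_symmetric (with_proj D) = G \<and> asym (parcs D)"

text \<open>The members of a partition in the sense of \<open>partition_on\<close> are nonempty.\<close>

definition multipartite_tournament :: "nat \<Rightarrow> 'a pair_pre_digraph \<Rightarrow> bool" where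
  "multipartite_tournament k D \<longleftrightarrow>
     (\<exists>P. finite P \<and> card P = k \<and> partition_on (pverts D) P \<and>
          orientation_of D (complete_multipartite_graph P))"

definition niche_graph :: "'a pair_pre_digraph \<Rightarrow> 'a pair_pre_digraph" where
  "niche_graph D =
     \<lparr> pverts = pverts D,
       parcs = {(u, v). u \<in> pverts D \<and> v \<in> pverts D \<and> u \<noteq> v \<and>
                  ((\<exists>w\<in>pverts D. (u, w) \<in> parcs D \<and> (v, w) \<in> parcs D) \<or>
                   (\<exists>w\<in>pverts D. (w, u) \<in> parcs D \<and> (w, v) \<in> parcs D))} \<rparr>"

text \<open>The path on \<open>n\<close> vertices.\<close>

definition path_graph :: "nat \<Rightarrow> nat pair_pre_digraph" where
  "path_graph n =
     \<lparr> pverts = {..<n}, parcs = {(i, j). i < n \<and> j < n \<and> (j = Suc i \<or> i = Suc j)} \<rparr>"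

text \<open>\<open>G\<close> is \<open>F\<close>-free: no induced subgraph of \<open>G\<close> is isomorphic to \<open>F\<close>.\<close>

definition induced_free :: "('b, 'c) pre_digraph \<Rightarrow> ('a, 'd) pre_digraph \<Rightarrow> bool" where
  "induced_free F G \<longleftrightarrow> \<not> (\<exists>H. induced_subgraph H G \<and> digraph_iso F H)"

end

theory Submission
  imports Defs
begin

text \<open>
  Among the arcs joining a vertex \<open>w\<close> to three vertices outside its part, two have the same
  direction with respect to \<open>w\<close>, so two of the three vertices are adjacent in the niche graph.
  Hence the parts of an independent triple cover all vertices; as there are at least three parts,
  they are three distinct parts and \<open>k = 3\<close>.  Let \<open>v\<^sub>0, \<dots>, v\<^sub>5\<close> be an induced path.  The
  independent triples \<open>v\<^sub>0v\<^sub>2v\<^sub>5\<close>, \<open>v\<^sub>0v\<^sub>3v\<^sub>5\<close>, \<open>v\<^sub>1v\<^sub>3v\<^sub>5\<close> show that \<open>v\<^sub>0, v\<^sub>1\<close> lie in a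
  common part and \<open>v\<^sub>2, v\<^sub>3\<close> in another one.  A vertex \<open>w\<close> witnessing the edge \<open>v\<^sub>1v\<^sub>2\<close> lies in
  neither part.  Along the non-edges \<open>v\<^sub>1v\<^sub>3\<close>, \<open>v\<^sub>3v\<^sub>0\<close>, \<open>v\<^sub>0v\<^sub>2\<close> the direction of the arc to \<open>w\<close>
  changes each time, so the arcs between \<open>w\<close> and \<open>v\<^sub>1, v\<^sub>2\<close> have opposite directions, a
  contradiction.
\<close>

text \<open>Trades the partition for the map \<open>p\<close> sending a vertex to its part, so that
  being joined by an arc becomes an inequality of values of \<open>p\<close>.\<close>

lemma multipartite_tournament_obtain_part:
  fixes D :: "'a pair_pre_digraph"
  assumes "multipartite_tournament k D"
  obtains p :: "'a \<Rightarrow> 'a set"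
  where "card (p ` pverts D) = k"
    and "\<forall>u\<in>pverts D. \<forall>v\<in>pverts D.
           p u \<noteq> p v \<longleftrightarrow> (u, v) \<in> parcs D \<or> (v, u) \<in> parcs D"
proof -
  from assms obtain P where card: "card P = k" and part: "partition_on (pverts D) P"
    and sym: "mk_symmetric (with_proj D) = complete_multipartite_graph P"
    unfolding multipartite_tournament_def orientation_of_def by auto
  define p where "p v = (THE X. X \<in> P \<and> v \<in> X)" for v
  have p_eq: "p v = X" if "X \<in> P" "v \<in> X" for v X
    unfolding p_def using that partition_onD2[OF part]
    by (intro the_equality) (auto dest: disjointD)
  have p_in: "p v \<in> P \<and> v \<in> p v" if "v \<in> pverts D" for v
    using that partition_onD1[OF part] p_eq by fastforce
  have img: "p ` pverts D = P"
  proof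
    show "P \<subseteq> p ` pverts D"
    proof
      fix X assume X: "X \<in> P"
      then obtain v where "v \<in> X" using partition_onD3[OF part] by fastforce
      with X p_eq partition_onD1[OF part] show "X \<in> p ` pverts D" by blast
    qed
  qed (use p_in in auto)
  have arcs: "(u, v) \<in> parcs D \<or> (v, u) \<in> parcs D \<longleftrightarrow>
      (u, v) \<in> parcs (complete_multipartite_graph P)" for u v
    unfolding sym[symmetric] parcs_mk_symmetric by (auto simp: Bex_def)
  have "p u \<noteq> p v \<longleftrightarrow> (u, v) \<in> parcs D \<or> (v, u) \<in> parcs D"
    if "u \<in> pverts D" "v \<in> pverts D" for u v
    unfolding arcs complete_multipartite_graph_def
    using p_in[OF that(1)] p_in[OF that(2)] p_eq[of _ u] p_eq[of _ v] by simp metis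
  with img card that show thesis by blast
qed

lemma niche_graph_independent_triple:
  assumes "card (p ` pverts D) \<ge> 3"
    and "\<And>u v. u \<in> pverts D \<Longrightarrow> v \<in> pverts D \<Longrightarrow>
           p u \<noteq> p v \<Longrightarrow> (u, v) \<in> parcs D \<or> (v, u) \<in> parcs D"
    and "{x, y, z} \<subseteq> pverts D" "distinct [x, y, z]"
    and "(x, y) \<notin> parcs (niche_graph D)" "(x, z) \<notin> parcs (niche_graph D)"
      "(y, z) \<notin> parcs (niche_graph D)"
  shows "p ` pverts D = {p x, p y, p z}" and "distinct [p x, p y, p z]"
proof -
  have "p w \<in> {p x, p y, p z}" if w: "w \<in> pverts D" for w
  proof (rule ccontr)
    assume "p w \<notin> {p x, p y, p z}"
    then have "(x, w) \<in> parcs D \<or> (w, x) \<in> parcs D" "(y, w) \<in> parcs D \<or> (w, y) \<in> parcs D"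
      "(z, w) \<in> parcs D \<or> (w, z) \<in> parcs D"
      using assms(2,3) w by auto
    with assms(3-7) w show False by (auto simp: niche_graph_def)
  qed
  with assms(3) show img: "p ` pverts D = {p x, p y, p z}" by auto
  show "distinct [p x, p y, p z]"
    using assms(1) unfolding img by (auto simp: card_insert_if split: if_splits)
qed

lemma niche_graph_no_induced_P6:
  fixes k :: nat and D :: "'a pair_pre_digraph"
  assumes "k \<ge> 3" and "multipartite_tournament k D"
    and inj: "inj_on f {..<6::nat}" and verts: "f ` {..<6} \<subseteq> pverts D"
    and arcs: "\<And>i j. i < 6 \<Longrightarrow> j < 6 \<Longrightarrow>
      (f i, f j) \<in> parcs (niche_graph D) \<longleftrightarrow> (i, j) \<in> parcs (path_graph 6)"
  shows False
proof -
  obtain p :: "'a \<Rightarrow> 'a set" where card_eq: "card (p ` pverts D) = k"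
    and "\<forall>u\<in>pverts D. \<forall>v\<in>pverts D. p u \<noteq> p v \<longleftrightarrow> (u, v) \<in> parcs D \<or> (v, u) \<in> parcs D"
    using multipartite_tournament_obtain_part[OF assms(2)] by blast
  then have p: "p u \<noteq> p v \<longleftrightarrow> (u, v) \<in> parcs D \<or> (v, u) \<in> parcs D"
    if "u \<in> pverts D" "v \<in> pverts D" for u v
    using that by blast
  have card: "card (p ` pverts D) \<ge> 3"
    using assms(1) card_eq by simp
  have V: "f i \<in> pverts D" if "i < 6" for i
    using verts that by auto
  \<comment> \<open>Index gaps of at least two make the three path vertices pairwise
    non-adjacent.\<close>
  have triple: "p ` pverts D = {p (f i), p (f j), p (f l)} \<and> distinct [p (f i), p (f j), p (f l)]"
    if "Suc i < j" "Suc j < l" "l < 6" for i j l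
  proof -
    have "distinct [f i, f j, f l]"
      using that by (simp add: inj_on_eq_iff[OF inj])
    moreover have "(f i, f j) \<notin> parcs (niche_graph D)" "(f i, f l) \<notin> parcs (niche_graph D)"
      "(f j, f l) \<notin> parcs (niche_graph D)"
      using that by (auto simp: arcs path_graph_def)
    moreover have "{f i, f j, f l} \<subseteq> pverts D"
      using V that by simp
    ultimately show ?thesis
      using niche_graph_independent_triple[OF card p[THEN iffD1], of "f i" "f j" "f l"] by blast
  qed
  \<comment> \<open>The triple 1, 3, 5 covers all parts, and independence of 0, 3, 5 rules out the
    parts of \<open>f 3\<close> and \<open>f 5\<close>.\<close>
  have "p (f 0) \<in> {p (f 1), p (f 3), p (f 5)}"
    using triple[of 1 3 5] imageI[OF V[of 0], of p] by simp
  then have p01: "p (f 0) = p (f 1)"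
    using triple[of 0 3 5] by simp
  \<comment> \<open>Likewise 0, 3, 5 covers all parts, and 0, 2, 5 rules out those of
    \<open>f 0\<close> and \<open>f 5\<close>.\<close>
  have "p (f 2) \<in> {p (f 0), p (f 3), p (f 5)}"
    using triple[of 0 3 5] imageI[OF V[of 2], of p] by simp
  then have p23: "p (f 2) = p (f 3)"
    using triple[of 0 2 5] by auto
  have "(f 1, f 2) \<in> parcs (niche_graph D)"
    by (simp add: arcs path_graph_def)
  then obtain w where w: "w \<in> pverts D"
    and w12: "(f 1, w) \<in> parcs D \<and> (f 2, w) \<in> parcs D \<or> (w, f 1) \<in> parcs D \<and> (w, f 2) \<in> parcs D"
    by (auto simp: niche_graph_def)
  \<comment> \<open>Since \<open>f 0\<close> and \<open>f 3\<close> share the parts of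
    \<open>f 1\<close> and \<open>f 2\<close>, the vertex \<open>w\<close> is joined to them as
    well.\<close>
  have "p w \<noteq> p (f 1)" "p w \<noteq> p (f 2)"
    using p[OF w V[of 1]] p[OF w V[of 2]] w12 by auto
  then have join: "(f 0, w) \<in> parcs D \<or> (w, f 0) \<in> parcs D"
      "(f 3, w) \<in> parcs D \<or> (w, f 3) \<in> parcs D"
    using p[OF w V[of 0]] p[OF w V[of 3]] p01 p23 by auto
  have opposite: "\<not> ((f i, w) \<in> parcs D \<and> (f j, w) \<in> parcs D) \<and>
      \<not> ((w, f i) \<in> parcs D \<and> (w, f j) \<in> parcs D)" if "Suc i < j" "j < 6" for i j
  proof -
    have "(f i, f j) \<notin> parcs (niche_graph D)" "f i \<noteq> f j"
      using that by (simp_all add: arcs path_graph_def inj_on_eq_iff[OF inj])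
    moreover have "f i \<in> pverts D" "f j \<in> pverts D"
      using V that by simp_all
    ultimately show ?thesis using w by (auto simp: niche_graph_def)
  qed
  show False
    using w12 join opposite[of 1 3] opposite[of 0 3] opposite[of 0 2] by simp blast
qed

text \<open>Reduces the isomorphic induced subgraph to its vertex map, an embedding that preserves
  and reflects arcs.\<close>

lemma not_induced_freeE:
  assumes "\<not> induced_free (with_proj F) (with_proj G)"
  obtains f where "inj_on f (pverts F)" "f ` pverts F \<subseteq> pverts G"
    "\<And>u v. u \<in> pverts F \<Longrightarrow> v \<in> pverts F \<Longrightarrow> (f u, f v) \<in> parcs G \<longleftrightarrow> (u, v) \<in> parcs F"
proof -
  from assms obtain H h where ind: "induced_subgraph H (with_proj G)"
    and iso: "pre_digraph.digraph_isomorphism (with_proj F) h" and H: "H = app_iso h (with_proj F)"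
    unfolding induced_free_def digraph_iso_def by blast
  let ?f = "iso_verts h"
  have inj: "inj_on ?f (pverts F)" and wf: "pair_wf_digraph F"
    using iso by (auto simp: pre_digraph.digraph_isomorphism_def wf_digraph_wp_iff)
  have verts: "verts H = ?f ` pverts F"
    by (simp add: H)
  \<comment> \<open>The end pairs of \<open>H\<close> are computed twice, as the image of the arcs
    of \<open>F\<close> and as the restriction of those of \<open>G\<close>; comparing the two gives
    the equivalence.\<close>
  have ends: "arcs_ends H = (\<lambda>(u, v). (?f u, ?f v)) ` parcs F"
    using wf_digraph.arcs_ends_app_iso_eq[OF _ iso] wf by (simp add: H wf_digraph_wp_iff)
  have ends': "arcs_ends H = {(u, v). (u, v) \<in> parcs G \<and> u \<in> verts H \<and> v \<in> verts H}"
    using ind by (auto simp: induced_subgraph_def subgraph_def compatible_def arcs_ends_conv)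
  have arcs: "(?f u, ?f v) \<in> parcs G \<longleftrightarrow> (u, v) \<in> parcs F"
    if uv: "u \<in> pverts F" "v \<in> pverts F" for u v
  proof -
    have "(?f u, ?f v) \<in> parcs G \<longleftrightarrow> (?f u, ?f v) \<in> arcs_ends H"
      using uv by (auto simp: ends' verts)
    also have "\<dots> \<longleftrightarrow> (u, v) \<in> parcs F"
      unfolding ends using uv pair_wf_digraph.in_arcsD1[OF wf] pair_wf_digraph.in_arcsD2[OF wf]
      by (auto simp: inj_on_eq_iff[OF inj])
    finally show ?thesis .
  qed
  from ind verts have "?f ` pverts F \<subseteq> pverts G"
    by (auto simp: induced_subgraph_def subgraph_def)
  with inj arcs that show thesis by blast
qed

theorem theorem4p4:
  fixes k :: nat and D :: "'a pair_pre_digraph"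
  assumes "k \<ge> 3" and "multipartite_tournament k D"
  shows "induced_free (with_proj (path_graph 6)) (with_proj (niche_graph D))"
proof (rule ccontr)
  assume "\<not> ?thesis"
  then obtain f :: "nat \<Rightarrow> 'a" where "inj_on f (pverts (path_graph 6))"
    "f ` pverts (path_graph 6) \<subseteq> pverts (niche_graph D)"
    "\<And>i j. i \<in> pverts (path_graph 6) \<Longrightarrow> j \<in> pverts (path_graph 6) \<Longrightarrow>
      (f i, f j) \<in> parcs (niche_graph D) \<longleftrightarrow> (i, j) \<in> parcs (path_graph 6)"
    by (elim not_induced_freeE) blast
  then have "inj_on f {..<6}" "f ` {..<6} \<subseteq> pverts D"
    "\<And>i j. i < 6 \<Longrightarrow> j < 6 \<Longrightarrow>
      (f i, f j) \<in> parcs (niche_graph D) \<longleftrightarrow> (i, j) \<in> parcs (path_graph 6)"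
    unfolding path_graph_def niche_graph_def by simp_all
  then show False by (rule niche_graph_no_induced_P6[OF assms])
qed

end
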